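(* Let $k$ be a field with $\operatorname{char} k\neq 2$, and let $f\in k[x]$ be a monic cubic polynomial with simple roots, whose quadratic coefficient (the coefficient of $x^2$) is $\alpha$. In the free skew field $k(\!\langle x,y\rangle\!)$ on two generators put $$b_1=(xy-yx)^{-1}(f-y^2),\qquad b_2=(xy-yx)^{-1}(x^2y-yx^2),$$ where $f=f(x)$, and define $$r=b_1^2-b_2-\alpha,\qquad s=y-xb_1+b_1r.$$ Then $r,s\in k(\!\langle x,y\rangle\!)\setminus k$, $rs=sr$, $s^2=f(r)$, and the centralizer of $r$ (and of $s$) in $k(\!\langle x,y\rangle\!)$ is not rational, i.e. it is not isomorphic as a $k$-algebra to the rational function field $k(t)$.
   Context: $k\langle x,y\rangle$ is the free associative $k$-algebra, and $k(\!\langle x,y\rangle\!)$ is its universal skew field of fractions (in the sense of P. M. Cohn): it is generated as a skew field by $k\langle x,y\rangle$, and a square matrix over $k\langle x,y\rangle$ is invertible over it if and only if the matrix is full, i.e. an $n\times n$ matrix not expressible as a product of an $n\times r$ and an $r\times n$ matrix over $k\langle x,y\rangle$ with $r<n$. "Simple roots" means that the roots in an algebraic closure of $k$ are pairwise distinct. *)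

theory Defs
  imports
    "HOL-Library.Poly_Mapping"
    "HOL-Algebra.Algebraic_Closure_Type"
    "HOL-Computational_Algebra.Computational_Algebra"
    "Jordan_Normal_Form.Matrix"
begin

section \<open>The free associative algebra on two generators\<close>

text \<open>
  Words are written additively, because the convolution product on
  \<^typ>\<open>'a \<Rightarrow>\<^sub>0 'b\<close> is defined over a \<^class>\<open>monoid_add\<close>. With concatenation as
  addition it is the product of the monoid algebra of the free monoid, that is, of the
  free associative algebra.
\<close>

datatype 'g word = Word (letters: "'g list")

instantiation word :: (type) monoid_add
begin

definition zero_word :: "'a word" where
  "zero_word = Word []"

definition plus_word :: "'a word \<Rightarrow> 'a word \<Rightarrow> 'a word" where
  "plus_word u v = Word (letters u @ letters v)"

instance
  by standard (simp_all add: zero_word_def plus_word_def)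

end

datatype gen = GenX | GenY

type_synonym 'k free_algebra = "gen word \<Rightarrow>\<^sub>0 'k"

definition gen :: "gen \<Rightarrow> 'k::field free_algebra" where
  "gen g = Poly_Mapping.single (Word [g]) 1"

definition const :: "'k::field \<Rightarrow> 'k free_algebra" where
  "const c = Poly_Mapping.single 0 c"


section \<open>The free skew field\<close>

definition full_mat :: "'a::ring_1 mat \<Rightarrow> bool" where
  "full_mat A \<longleftrightarrow> square_mat A \<and>
     \<not> (\<exists>r P Q. r < dim_row A \<and> P \<in> carrier_mat (dim_row A) r \<and>
                Q \<in> carrier_mat r (dim_row A) \<and> A = P * Q)"

inductive_set skew_field_generated :: "'a::division_ring set \<Rightarrow> 'a set" for S where
  incl: "a \<in> S \<Longrightarrow> a \<in> skew_field_generated S"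
| one: "1 \<in> skew_field_generated S"
| diff: "a \<in> skew_field_generated S \<Longrightarrow> b \<in> skew_field_generated S \<Longrightarrow>
           a - b \<in> skew_field_generated S"
| mult: "a \<in> skew_field_generated S \<Longrightarrow> b \<in> skew_field_generated S \<Longrightarrow>
           a * b \<in> skew_field_generated S"
| inverse: "a \<in> skew_field_generated S \<Longrightarrow> inverse a \<in> skew_field_generated S"

text \<open>
  A skew field \<^typ>\<open>'d\<close> together with a homomorphism \<open>\<iota>\<close> from the free algebra is the
  universal skew field of fractions of the free algebra if it is generated by the image of
  \<open>\<iota>\<close> and precisely the full matrices become invertible. This determines \<open>\<iota>\<close> up to a
  unique isomorphism. That \<open>\<iota>\<close> is injective is the case of 1 by 1 matrices, and that the
  image of \<^term>\<open>const\<close> is central follows from generation, so that \<^typ>\<open>'d\<close> is an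
  algebra over \<^typ>\<open>'k\<close> through \<open>\<iota> \<circ> const\<close>.
\<close>

locale free_skew_field = Ring_Hom.ring_hom \<iota>
  for \<iota> :: "'k::field free_algebra \<Rightarrow> 'd::division_ring" +
  assumes generated: "skew_field_generated (range \<iota>) = UNIV"
    and invertible_iff_full: "square_mat A \<Longrightarrow> invertible_mat (map_mat \<iota> A) \<longleftrightarrow> full_mat A"

text \<open>The library's \<^const>\<open>poly\<close> evaluates over commutative rings only.\<close>

definition poly_at :: "('k::field free_algebra \<Rightarrow> 'd::division_ring) \<Rightarrow> 'k poly \<Rightarrow> 'd \<Rightarrow> 'd" where
  "poly_at \<iota> p z = (\<Sum>i\<le>degree p. \<iota> (const (coeff p i)) * z ^ i)"

definition centralizer :: "'a::times \<Rightarrow> 'a set" where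
  "centralizer a = {z. z * a = a * z}"

definition rational :: "('k::field free_algebra \<Rightarrow> 'd::division_ring) \<Rightarrow> 'd set \<Rightarrow> bool" where
  "rational \<iota> A \<longleftrightarrow> (\<exists>\<phi> :: 'k poly fract \<Rightarrow> 'd. Ring_Hom.ring_hom \<phi> \<and>
     bij_betw \<phi> UNIV A \<and> (\<forall>c. \<phi> (to_fract [:c:]) = \<iota> (const c)))"

end

theory Submission
  imports Defs "Jordan_Normal_Form.Char_Poly"
begin

text \<open>
  The equations \<open>rs = sr\<close> and \<open>s^2 = f(r)\<close> are a noncommutative form of the chord construction on the
  elliptic curve \<open>s^2 = f(r)\<close> and hold in every skew field in which \<open>xy - yx\<close> is invertible. If \<open>r\<close> or
  \<open>s\<close> were a constant, clearing inverses would give a square matrix over the free algebra which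
  annihilates a nonzero vector over the skew field, hence is not full; but this matrix stays
  invertible when \<open>x\<close> and \<open>y\<close> are replaced by suitable scalars, since \<open>xy - yx\<close> and \<open>x^2y - yx^2\<close>
  vanish there and \<open>f - y^2\<close> need not. Both centralizers contain \<open>r\<close> and \<open>s\<close>, so an isomorphism
  with \<open>k(t)\<close> would yield a nonconstant solution of \<open>S^2 = f(R)\<close> in \<open>k(t)\<close>, which Fermat's descent
  on four squares in a pencil excludes.
\<close>

section \<open>The curve relation in a skew field\<close>

lemma noncommutative_cubic_curve:
  fixes x y z r s b1 b2 \<alpha> \<beta> \<gamma> :: "'d::division_ring"
  defines "F \<equiv> \<lambda>u. \<gamma> + \<beta> * u + \<alpha> * u^2 + u^3"
  assumes central: "\<And>u. u * \<alpha> = \<alpha> * u" "\<And>u. u * \<beta> = \<beta> * u" "\<And>u. u * \<gamma> = \<gamma> * u"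
    and z: "z = x * y - y * x" "z \<noteq> 0"
    and b1: "z * b1 = F x - y^2"
    and b2: "z * b2 = x^2 * y - y * x^2"
    and r: "r = b1^2 - b2 - \<alpha>"
    and s: "s = y - x * b1 + b1 * r"
  shows "r * s = s * r" "s^2 = F r"
proof -
  \<comment> \<open>On \<open>t^3 + \<alpha> t^2 + \<beta> t + \<gamma> = u^2\<close>, \<open>b1\<close> plays the role of the slope of a line through \<open>(x, y)\<close>
    and the conjugate \<open>(x', - y')\<close>, and \<open>r\<close> is the first coordinate of the third intersection point.\<close>
  define x' y' where "x' = inverse z * x * z" and "y' = inverse z * y * z"
  have lift: "u * (c * w) = c * (u * w)" if "\<And>u. u * c = c * u" for c u w :: 'd
    using that by (metis mult.assoc)
  note c1 = central[of x] central[of y] central[of z] central[of x'] central[of y']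
     central[of b1] central[of r] central[of s]
  note cl = lift[OF central(1)] lift[OF central(2)] lift[OF central(3)]
  note c2 = cl[of x] cl[of y] cl[of z] cl[of x'] cl[of y'] cl[of b1] cl[of r] cl[of s]
  note ring = algebra_simps power2_eq_square power3_eq_cube c1 c2
  have x': "z * x' = x * z" "z * (x' * u) = x * (z * u)" for u
    using z(2) unfolding x'_def by (simp_all add: mult.assoc[symmetric])
  have y': "z * y' = y * z" "z * (y' * u) = y * (z * u)" for u
    using z(2) unfolding y'_def by (simp_all add: mult.assoc[symmetric])
  have cancel: "u = v" if "z * u = z * v" for u v
    using that z(2) by simp
  have l2: "z * (b1 * u) = (F x - y^2) * u" for u
    using b1 by (metis mult.assoc)
  have xy: "x * y = y * x + z" "x * (y * u) = y * (x * u) + z * u" for u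
    by (simp_all add: z(1) algebra_simps)
  \<comment> \<open>The numerator \<open>x^2 * y - y * x^2\<close> equals
    \<open>x * z + z * x\<close>, and \<open>x * z = z * x'\<close>.\<close>
  have b2': "b2 = x + x'"
    by (rule cancel) (simp add: b2 x' xy ring)
  \<comment> \<open>After multiplication by \<open>z\<close>, the difference
    \<open>b1 * x - x' * b1\<close> becomes the commutator of \<open>x\<close> with
    \<open>y^2\<close>. In the next relation \<open>b1 * y - y' * b1\<close> becomes the commutator
    of \<open>F x\<close> with \<open>y\<close>. Moving \<open>b1\<close> past \<open>x\<close> and
    \<open>y\<close> by these rules reduces the identities below to comparing normal forms.\<close>
  have A: "b1 * x = x' * b1 + y + y'"
    by (rule cancel) (simp add: x' y' l2 b1 F_def xy ring)
  have B: "b1 * y = y' * b1 + x'^2 + x' * x + x^2 + \<alpha> * (x' + x) + \<beta>"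
    by (rule cancel) (simp add: x' y' l2 b1 F_def xy ring)
  have C: "x' * y' = y' * x' + z"
    by (rule cancel) (simp add: x' y' xy ring)
  have A2: "b1 * (x * u) = (x' * b1 + y + y') * u" for u
    using A by (metis mult.assoc)
  have B2: "b1 * (y * u) = (y' * b1 + x'^2 + x' * x + x^2 + \<alpha> * (x' + x) + \<beta>) * u" for u
    using B by (metis mult.assoc)
  have C2: "x' * (y' * u) = y' * (x' * u) + z * u" for u
    using C by (metis mult.assoc distrib_right)
  show rs: "r * s = s * r"
    unfolding s r b2' by (simp add: A B C A2 B2 C2 xy ring)
  \<comment> \<open>For a commutative chord of slope \<open>b1\<close> this says that slope times
    sum of ordinates, \<open>b1 * (s + y)\<close>, is the divided difference of \<open>F\<close> at
    \<open>x\<close> and \<open>r\<close>.\<close>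
  have b1s: "b1 * s = r^2 + \<alpha> * r + \<beta> + x^2 + \<alpha> * x + x * r - y * b1"
    unfolding s r b2' by (simp add: A B C A2 B2 C2 xy ring)
  have b1sr: "b1 * (s * r) = (r^2 + \<alpha> * r + \<beta> + x^2 + \<alpha> * x + x * r - y * b1) * r"
    using b1s by (metis mult.assoc)
  have mu: "y - x * b1 = s - b1 * r" using s by simp
  have xb: "x * (b1 * s) = x * (r^2 + \<alpha> * r + \<beta> + x^2 + \<alpha> * x + x * r - y * b1)"
    using b1s by simp
  have "s^2 = (y - x * b1) * s + b1 * (s * r)"
    unfolding mu by (simp add: ring rs)
  also have "\<dots> = y * (y - x * b1 + b1 * r) - x * (b1 * s) + b1 * (s * r)"
    using arg_cong[OF s, of "(*) y"] by (simp add: left_diff_distrib mult.assoc)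
  \<comment> \<open>The terms \<open>x * (y * b1)\<close> and \<open>- y * (x * b1)\<close> combine
    to \<open>z * b1\<close>, that is \<open>F x - y^2\<close>. This cancels the remaining terms in
    \<open>x\<close> and \<open>y\<close> and supplies \<gamma>.\<close>
  also have "\<dots> = F r"
    unfolding xb b1sr using b1 by (simp add: F_def xy ring)
  finally show "s^2 = F r" .
qed

section \<open>Elliptic curves over rational function fields\<close>

lemma const_is_square:
  fixes p :: "'a::alg_closed_field poly"
  assumes "degree p = 0"
  shows "\<exists>u. p = u^2"
proof -
  obtain c where "p = [:c:]" using assms degree_eq_zeroE by blast
  moreover obtain d where "d^2 = c" using nth_root_exists[of 2 c] by auto
  ultimately show ?thesis by (intro exI[of _ "[:d:]"]) (simp add: power2_eq_square)
qed

lemma smult_is_square: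
  fixes p :: "'a::alg_closed_field poly"
  shows "\<exists>u. smult c (p^2) = u^2"
proof -
  obtain d where "d^2 = c" using nth_root_exists[of 2 c] by auto
  then show ?thesis by (intro exI[of _ "smult d p"]) (simp add: smult_power)
qed

text \<open>A root of \<open>v\<close> is a root of \<open>w\<close>, so a linear factor can be
  cancelled from both until \<open>v\<close> is constant; the constant is absorbed into the
  square.\<close>

lemma square_div_square:
  fixes m v w :: "'a::alg_closed_field poly"
  assumes "v^2 * m = w^2" "v \<noteq> 0"
  shows "\<exists>u. m = u^2"
  using assms
proof (induction "degree v" arbitrary: v w rule: less_induct)
  case less
  show ?case
  proof (cases "degree v = 0")
    case True
    then obtain c where c: "v = [:c:]" using degree_eq_zeroE by blast
    with less.prems have "smult (c^2) m = w^2" "c \<noteq> 0" by (auto simp: power2_eq_square)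
    then have "m = smult (1 / c^2) (w^2)"
      by (metis power_not_zero smult_smult smult_1_left nonzero_divide_eq_eq)
    then show ?thesis using smult_is_square by metis
  next
    case False
    then obtain z where z: "poly v z = 0" using alg_closed_imp_poly_has_root[of v] by auto
    then obtain v1 where v1: "v = [:-z, 1:] * v1" by (metis poly_eq_0_iff_dvd dvdE)
    have "poly w z = 0"
      using arg_cong[OF less.prems(1), of "\<lambda>p. poly p z"] z by simp
    then obtain w1 where w1: "w = [:-z, 1:] * w1" by (metis poly_eq_0_iff_dvd dvdE)
    have "[:-z, 1:]^2 * (v1^2 * m) = [:-z, 1:]^2 * w1^2"
      using less.prems(1) unfolding v1 w1 by (simp only: power_mult_distrib mult.assoc)
    then have eq: "v1^2 * m = w1^2" by (subst (asm) mult_cancel_left) simp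
    have "v1 \<noteq> 0" using less.prems(2) v1 by auto
    then have "degree v1 < degree v" unfolding v1 by (subst degree_mult_eq) auto
    then show ?thesis using less.hyps eq \<open>v1 \<noteq> 0\<close> by blast
  qed
qed

text \<open>Each root of \<open>w\<close> is a root of exactly one of the two factors, which
  therefore contains the square of the linear factor. Removing it lowers the degree of
  \<open>w\<close>.\<close>

lemma square_factor:
  fixes a b w :: "'a::alg_closed_field poly"
  assumes "a * b = w^2" "\<And>z. poly a z = 0 \<Longrightarrow> poly b z \<noteq> 0"
  shows "\<exists>u. a = u^2"
  using assms
proof (induction "degree w" arbitrary: a b w rule: less_induct)
  case less
  consider "w = 0" | "w \<noteq> 0" "degree w = 0" | "degree w > 0" by blast
  then show ?case
  proof cases
    case 1
    with less.prems consider "a = 0" | "b = 0" by auto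
    then show ?thesis
    proof cases
      case 1 then show ?thesis by (intro exI[of _ 0]) simp
    next
      case 2
      \<comment> \<open>With \<open>b = 0\<close> the hypothesis leaves \<open>a\<close> without
        roots.\<close>
      then have "degree a = 0"
        using less.prems(2) alg_closed_imp_poly_has_root[of a] by auto
      then show ?thesis by (rule const_is_square)
    qed
  next
    case 2
    then have "a \<noteq> 0" "b \<noteq> 0" using less.prems(1) by auto
    then have "degree a + degree b = 0"
      using arg_cong[OF less.prems(1), of degree] 2 by (simp add: degree_mult_eq degree_power_eq)
    then show ?thesis by (intro const_is_square) simp
  next
    case 3
    then obtain z where z: "poly w z = 0" using alg_closed_imp_poly_has_root[of w] by auto
    then obtain w1 where w1: "w = [:-z, 1:] * w1" by (metis poly_eq_0_iff_dvd dvdE)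
    have "w1 \<noteq> 0" using 3 w1 by auto
    then have deg: "degree w1 < degree w" unfolding w1 by (subst degree_mult_eq) auto
    \<comment> \<open>Stated for an arbitrary pair, because either \<open>a\<close> or
      \<open>b\<close> may be the factor that vanishes at \<open>z\<close>.\<close>
    have split: "\<exists>c2. c = [:-z, 1:]^2 * c2 \<and> c2 * d = w1^2"
      if cd: "c * d = w^2" "poly c z = 0" "poly d z \<noteq> 0" for c d
    proof -
      obtain c1 where c1: "c = [:-z, 1:] * c1" using cd(2) by (metis poly_eq_0_iff_dvd dvdE)
      have "[:-z, 1:] * (c1 * d) = [:-z, 1:] * ([:-z, 1:] * w1^2)"
        using cd(1) unfolding c1 w1 by (simp only: power2_eq_square ac_simps)
      then have eq: "c1 * d = [:-z, 1:] * w1^2" by (subst (asm) mult_cancel_left) simp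
      have "poly c1 z = 0" using arg_cong[OF eq, of "\<lambda>p. poly p z"] cd(3) by simp
      then obtain c2 where c2: "c1 = [:-z, 1:] * c2" by (metis poly_eq_0_iff_dvd dvdE)
      have "[:-z, 1:] * (c2 * d) = [:-z, 1:] * w1^2"
        using eq unfolding c2 by (simp only: ac_simps)
      then have "c2 * d = w1^2" by (subst (asm) mult_cancel_left) simp
      moreover have "c = [:-z, 1:]^2 * c2" unfolding c1 c2 by (simp only: power2_eq_square ac_simps)
      ultimately show ?thesis by blast
    qed
    have ab: "poly a z = 0 \<or> poly b z = 0"
      using arg_cong[OF less.prems(1), of "\<lambda>p. poly p z"] z by simp
    show ?thesis
    proof (cases "poly a z = 0")
      case True
      with split[OF less.prems(1)] less.prems(2)
      obtain a2 where a2: "a = [:-z, 1:]^2 * a2" "a2 * b = w1^2" by blast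
      have "\<exists>u. a2 = u^2"
        by (rule less.hyps[OF deg a2(2)]) (use less.prems(2) a2(1) in auto)
      then show ?thesis using a2(1) by (metis power_mult_distrib)
    next
      case False
      with ab have "poly b z = 0" by blast
      with split[of b a] less.prems(1) False
      obtain b2 where b2: "b = [:-z, 1:]^2 * b2" "b2 * a = w1^2" by (metis mult.commute)
      show ?thesis
        by (rule less.hyps[OF deg, of a b2]) (use less.prems(2) b2 in \<open>auto simp: mult.commute\<close>)
    qed
  qed
qed

text \<open>
  Infinite descent: if \<open>p = u^2\<close>, \<open>q = v^2\<close> and \<open>l = m^2\<close>, then \<open>u - v\<close>, \<open>u + v\<close>, \<open>u - m v\<close>, \<open>u + m v\<close>
  are four squares in the pencil spanned by \<open>u\<close> and \<open>v\<close>, whose degrees are half as large.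
\<close>

lemma four_squares_in_pencil:
  fixes p q :: "'a::alg_closed_field poly"
  assumes "(2::'a) \<noteq> 0" "l \<noteq> 0" "l \<noteq> 1"
    and "\<And>z. poly p z = 0 \<Longrightarrow> poly q z \<noteq> 0"
    and "\<exists>u. p = u^2" "\<exists>u. q = u^2" "\<exists>u. p - q = u^2" "\<exists>u. p - smult l q = u^2"
  shows "degree p = 0 \<and> degree q = 0"
  using assms(2-)
proof (induction "max (degree p) (degree q)" arbitrary: p q l rule: less_induct)
  case less
  show ?case
  proof (rule ccontr)
    assume nc: "\<not> ?thesis"
    obtain u v w w' m where u: "p = u^2" and v: "q = v^2" and w: "p - q = w^2"
      and w': "p - smult l q = w'^2" and m: "m^2 = l"
      using less.prems(4-) nth_root_exists[of 2 l] by auto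
    have m0: "m \<noteq> 0" "m \<noteq> 1" "m \<noteq> -1" "1 + m \<noteq> 0" "1 - m \<noteq> 0"
      using m less.prems(1,2) by (auto simp: add_eq_0_iff)
    have cop: "\<not> (poly u z = 0 \<and> poly v z = 0)" for z
      using less.prems(3)[of z] u v by auto
    have two: "a = 0" if "a + a = 0" for a :: 'a
      using that assms(1) by (metis mult_2 mult_eq_0_iff)
    \<comment> \<open>A common root of \<open>u + c v\<close> and \<open>u - c v\<close> would be a
      common root of \<open>u\<close> and \<open>v\<close>, as 2 is invertible.\<close>
    have sq: "\<exists>t. u + smult c v = t^2"
      if c: "c \<noteq> 0" "(u + smult c v) * (u + smult (-c) v) = s^2" for c s
    proof (rule square_factor[OF c(2)])
      fix z assume z: "poly (u + smult c v) z = 0"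
      show "poly (u + smult (- c) v) z \<noteq> 0"
      proof
        assume z': "poly (u + smult (- c) v) z = 0"
        have "poly u z + poly u z = 0" "c * poly v z + c * poly v z = 0"
          using z z' by (auto simp: algebra_simps add_eq_0_iff)
        then show False using two cop[of z] c(1) by (metis mult_eq_0_iff)
      qed
    qed
    have "(u + smult 1 v) * (u + smult (-1) v) = w^2" "(u + smult (-1) v) * (u + smult (-(-1)) v) = w^2"
      using w u v by (simp_all add: algebra_simps power2_eq_square)
    from sq[OF _ this(1)] sq[OF _ this(2)] obtain s1 s2
      where s: "u + v = s1^2" "u - v = s2^2" by auto
    have "(u + smult m v) * (u + smult (-m) v) = w'^2" "(u + smult (-m) v) * (u + smult (-(-m)) v) = w'^2"
      using w' u v m by (simp_all add: algebra_simps power2_eq_square)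
    from sq[OF _ this(1)] sq[OF _ this(2)] m0 obtain s3 s4
      where s': "u + smult m v = s3^2" "u - smult m v = s4^2" by auto
    \<comment> \<open>The Moebius map of \<open>u / v\<close> sending 1, -1, \<open>m\<close> to 0,
      infinity, 1 sends \<open>-m\<close> to \<open>k^2\<close>. Hence \<open>p'\<close>,
      \<open>q'\<close>, \<open>p' - q'\<close>, \<open>p' - k^2 q'\<close> are scalar multiples of
      \<open>u - v\<close>, \<open>u + v\<close>, \<open>u - m v\<close>,
      \<open>u + m v\<close>.\<close>
    define p' q' k where "p' = smult (1 + m) (u - v)" and "q' = smult (m - 1) (u + v)"
      and "k = (1 + m) / (1 - m)"
    have degp: "degree p = 2 * degree u" "degree q = 2 * degree v"
      unfolding u v by (cases "u = 0"; cases "v = 0"; simp add: degree_power_eq)+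
    have degp': "degree p' \<le> max (degree u) (degree v)" "degree q' \<le> max (degree u) (degree v)"
      unfolding p'_def q'_def
      by (meson degree_smult_le degree_diff_le_max degree_add_le_max order_trans)+
    have "degree p' = 0 \<and> degree q' = 0"
    proof (rule less.hyps[of p' q' "k^2"])
      show "max (degree p') (degree q') < max (degree p) (degree q)"
        using degp degp' nc by linarith
      show "k^2 \<noteq> 0" using m0 by (simp add: k_def)
      show "k^2 \<noteq> 1"
      proof
        assume "k^2 = 1"
        then have "(1 + m)^2 = (1 - m)^2" using m0 by (simp add: k_def power_divide)
        then have "(m + m) + (m + m) = 0" by (simp add: algebra_simps power2_eq_square)
        then show False using two m0(1) by blast
      qed
      show "poly q' z \<noteq> 0" if "poly p' z = 0" for z
      proof
        assume "poly q' z = 0"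
        with that have e: "poly u z - poly v z = 0" "poly u z + poly v z = 0"
          using m0 by (auto simp: p'_def q'_def)
        then have "poly v z + poly v z = 0" by simp
        then have "poly v z = 0" by (rule two)
        with e cop[of z] show False by auto
      qed
      show "\<exists>t. p' = t^2" "\<exists>t. q' = t^2"
        unfolding p'_def q'_def s by (rule smult_is_square)+
      have "p' - q' = smult 2 (u - smult m v)"
        by (intro poly_eqI) (simp add: p'_def q'_def algebra_simps)
      then show "\<exists>t. p' - q' = t^2" unfolding s' by (simp only: smult_is_square)
      have k1: "k * (1 - m) = 1 + m" using m0 by (simp add: k_def)
      have "k^2 * (m - 1) = - k * (k * (1 - m))" by (simp add: power2_eq_square algebra_simps)
      then have k2: "k^2 * (m - 1) = - k * (1 + m)" unfolding k1 .
      have "p' - smult (k^2) q' = smult (k * (1 - m)) (u - v) - smult (k^2 * (m - 1)) (u + v)"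
        unfolding k1 by (simp add: p'_def q'_def)
      also have "\<dots> = smult k (smult 2 (u + smult m v))"
        unfolding k2
        by (intro poly_eqI) (simp add: algebra_simps)
      finally show "\<exists>t. p' - smult (k^2) q' = t^2"
        unfolding s' smult_smult by (simp only: smult_is_square)
    qed
    then have d: "degree (u - v) = 0" "degree (u + v) = 0" using m0 by (auto simp: p'_def q'_def)
    have "smult 2 u = (u + v) + (u - v)" "smult 2 v = (u + v) - (u - v)"
      by (intro poly_eqI, simp only: coeff_smult coeff_add coeff_diff, simp)+
    then have "degree (smult 2 u) \<le> 0" "degree (smult 2 v) \<le> 0"
      using degree_add_le[of "u + v" 0 "u - v"] degree_diff_le[of "u + v" 0 "u - v"] d by simp_all
    then show False using nc degp assms(1) by simp
  qed
qed

section \<open>Parametrisations of the cubic curve\<close>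

text \<open>One more factor \<open>q\<close> turns the left side of \<open>eq\<close> into the
  square of \<open>u * q^2\<close>. Then \<open>q\<close> and the three linear forms have a square
  as product and pairwise no common roots, so each is a square.\<close>

lemma elliptic_curve_no_polynomial_param:
  fixes p q u v :: "'a::alg_closed_field poly"
  assumes two: "(2::'a) \<noteq> 0" and dist: "a \<noteq> b" "a \<noteq> c" "b \<noteq> c"
    and "q \<noteq> 0" "v \<noteq> 0"
    and cop: "\<And>z. poly p z = 0 \<Longrightarrow> poly q z \<noteq> 0"
    and eq: "u^2 * q^3 = v^2 * ((p - smult a q) * (p - smult b q) * (p - smult c q))"
  shows "degree p = 0" "degree q = 0"
proof -
  let ?l = "\<lambda>e. p - smult e q"
  have "v^2 * (q * (?l a * ?l b * ?l c)) = q * (u^2 * q^3)"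
    unfolding eq by (simp only: ac_simps)
  also have "\<dots> = (u * q^2)^2"
    by (simp add: power_mult_distrib power2_eq_square power3_eq_cube ac_simps)
  finally obtain w where w: "q * (?l a * ?l b * ?l c) = w^2"
    using square_div_square \<open>v \<noteq> 0\<close> by blast
  have lq: "poly q z \<noteq> 0" if "poly (?l e) z = 0" for e z
    using that cop[of z] by auto
  have ll: "poly (?l e) z \<noteq> 0" if "poly (?l d) z = 0" "d \<noteq> e" for d e z
  proof
    assume "poly (?l e) z = 0"
    with that have "d * poly q z = e * poly q z" by simp
    then show False using lq[OF that(1)] that(2) by simp
  qed
  have "poly p z \<noteq> e * poly q z" if "poly q z = 0" for e z
    using that cop[of z] by auto
  then have sq: "\<exists>t. q = t^2"
    by (intro square_factor[OF w]) simp
  have la: "\<exists>t. ?l a = t^2"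
  proof (rule square_factor)
    show "?l a * (q * ?l b * ?l c) = w^2" using w by (simp only: ac_simps)
    show "poly (q * ?l b * ?l c) z \<noteq> 0" if "poly (?l a) z = 0" for z
      using lq[OF that] ll[OF that dist(1)] ll[OF that dist(2)] by simp
  qed
  have lb: "\<exists>t. ?l b = t^2"
  proof (rule square_factor)
    show "?l b * (q * ?l a * ?l c) = w^2" using w by (simp only: ac_simps)
    show "poly (q * ?l a * ?l c) z \<noteq> 0" if "poly (?l b) z = 0" for z
      using lq[OF that] ll[OF that dist(1)[symmetric]] ll[OF that dist(3)] by simp
  qed
  have lc: "\<exists>t. ?l c = t^2"
  proof (rule square_factor)
    show "?l c * (q * ?l a * ?l b) = w^2" using w by (simp only: ac_simps)
    show "poly (q * ?l a * ?l b) z \<noteq> 0" if "poly (?l c) z = 0" for z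
      using lq[OF that] ll[OF that dist(2)[symmetric]] ll[OF that dist(3)[symmetric]] by simp
  qed
  \<comment> \<open>In the basis \<open>p - a q\<close>, \<open>(b - a) q\<close> the pencil takes
    the normalised form with parameter \<open>(c - a) / (b - a)\<close>, which differs from 0 and 1
    because the roots are distinct.\<close>
  have e1: "?l a - smult (b - a) q = ?l b"
    by (simp add: smult_diff_left)
  have e2: "?l a - smult ((c - a) / (b - a)) (smult (b - a) q) = ?l c"
    using dist unfolding smult_smult by (simp add: smult_diff_left)
  have "degree (?l a) = 0 \<and> degree (smult (b - a) q) = 0"
  proof (rule four_squares_in_pencil[OF two])
    show "(c - a) / (b - a) \<noteq> 0" "(c - a) / (b - a) \<noteq> 1"
      using dist by auto
    show "poly (smult (b - a) q) z \<noteq> 0" if "poly (?l a) z = 0" for z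
      using lq[OF that] dist by simp
    show "\<exists>t. smult (b - a) q = t^2"
      using sq smult_is_square by auto
    show "\<exists>t. ?l a - smult (b - a) q = t^2"
      "\<exists>t. ?l a - smult ((c - a) / (b - a)) (smult (b - a) q) = t^2"
      unfolding e1 e2 by (fact lb lc)+
  qed (fact la)
  then show "degree q = 0" "degree p = 0"
    using dist degree_add_le[of "?l a" 0 "smult a q"] by auto
qed

lemma alg_closed_rsquarefree_cubic_splits:
  fixes f :: "'a::alg_closed_field poly"
  assumes "degree f = 3" "lead_coeff f = 1" "rsquarefree f"
  shows "\<exists>a b c. a \<noteq> b \<and> a \<noteq> c \<and> b \<noteq> c \<and> f = [:-a, 1:] * [:-b, 1:] * [:-c, 1:]"
proof -
  have "f \<noteq> 0" using assms(1) by auto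
  then obtain A where A: "size A = 3" "f = (\<Prod>x\<in>#A. [:-x, 1:])"
    using alg_closed_imp_factorization[of f] assms by auto
  obtain a A1 where a: "A = add_mset a A1" "size A1 = Suc (Suc 0)"
    using size_eq_Suc_imp_eq_union[of A "Suc (Suc 0)"] A(1) by auto
  obtain b A2 where b: "A1 = add_mset b A2" "size A2 = Suc 0"
    using size_eq_Suc_imp_eq_union[OF a(2)] a(2) by auto
  obtain c where "A2 = {#c#}"
    using b(2) size_1_singleton_mset by auto
  with a b have "A = {#a, b, c#}" by simp
  with A have f: "f = [:-a, 1:] * [:-b, 1:] * [:-c, 1:]"
    by (simp add: ac_simps del: mult_pCons_left mult_pCons_right)
  have no_square: "f \<noteq> [:-x, 1:]^2 * g" for x g
  proof
    assume "f = [:-x, 1:]^2 * g"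
    then have "2 \<le> order x f" using order_divides[of x 2 f] \<open>f \<noteq> 0\<close> by auto
    moreover have "order x f = 0 \<or> order x f = 1"
      using assms(3) by (simp add: rsquarefree_def)
    ultimately show False by linarith
  qed
  have "a \<noteq> b" using no_square[of a "[:-c, 1:]"] f by (auto simp only: power2_eq_square ac_simps)
  moreover have "a \<noteq> c" using no_square[of a "[:-b, 1:]"] f by (auto simp only: power2_eq_square ac_simps)
  moreover have "b \<noteq> c" using no_square[of b "[:-a, 1:]"] f by (auto simp only: power2_eq_square ac_simps)
  ultimately show ?thesis using f by blast
qed

text \<open>Clearing denominators and passing to the algebraic closure, where \<open>f\<close>
  splits, reduces to the polynomial case. It remains to bring the resulting constant back to the
  base field.\<close>

lemma elliptic_curve_no_rational_param:
  fixes f :: "'k::field poly" and R S :: "'k poly fract"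
  assumes two: "(2::'k) \<noteq> 0" and f: "degree f = 3" "lead_coeff f = 1" "rsquarefree (map_poly to_ac f)"
    and RS: "S^2 = (\<Sum>i\<le>degree f. to_fract [:coeff f i:] * R^i)"
  shows "\<exists>c. R = to_fract [:c:]"
proof -
  obtain P Q where R: "R = to_fract P / to_fract Q" "Q \<noteq> 0"
    by (metis Fract_cases Fract_conv_to_fract)
  obtain U V where S: "S = to_fract U / to_fract V" "V \<noteq> 0"
    by (metis Fract_cases Fract_conv_to_fract)
  define ga be al where "ga = coeff f 0" "be = coeff f 1" "al = coeff f 2"
  have "S^2 = to_fract [:ga:] + to_fract [:be:] * R + to_fract [:al:] * R^2 + R^3"
    using RS f(1,2) by (simp add: numeral_3_eq_3 numeral_2_eq_2 ga_be_al_def flip: one_pCons)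
  then have "to_fract U^2 * to_fract Q^3 = to_fract V^2 * (to_fract [:ga:] * to_fract Q^3
      + to_fract [:be:] * to_fract P * to_fract Q^2 + to_fract [:al:] * to_fract P^2 * to_fract Q + to_fract P^3)"
    using R S by (simp add: field_simps power2_eq_square power3_eq_cube)
  then have "to_fract (U^2 * Q^3) = to_fract (V^2 * ([:ga:] * Q^3
      + [:be:] * P * Q^2 + [:al:] * P^2 * Q + P^3))"
    by (simp add: power2_eq_square power3_eq_cube del: mult_pCons_left mult_pCons_right)
  then have eq: "U^2 * Q^3 = V^2 * ([:ga:] * Q^3 + [:be:] * P * Q^2 + [:al:] * P^2 * Q + P^3)"
    by (simp only: to_fract_eq_iff)
  interpret ac: map_poly_inj_comm_ring_hom "to_ac :: 'k \<Rightarrow> 'k alg_closure"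
    by unfold_locales simp_all
  let ?h = "map_poly (to_ac :: 'k \<Rightarrow> 'k alg_closure)"
  have h: "?h U^2 * ?h Q^3 = ?h V^2 * ([:to_ac ga:] * ?h Q^3 + [:to_ac be:] * ?h P * ?h Q^2
      + [:to_ac al:] * ?h P^2 * ?h Q + ?h P^3)"
    using arg_cong[OF eq, of ?h]
    by (simp add: hom_distribs del: mult_pCons_left mult_pCons_right)
  have deg: "degree (?h f) = 3" "lead_coeff (?h f) = 1"
    using f by simp_all
  obtain a b c where abc: "a \<noteq> b" "a \<noteq> c" "b \<noteq> c" "?h f = [:-a, 1:] * [:-b, 1:] * [:-c, 1:]"
    using alg_closed_rsquarefree_cubic_splits[OF deg f(3)] by blast
  have co: "to_ac ga = - (a * b * c)" "to_ac be = a * b + a * c + b * c" "to_ac al = - (a + b + c)"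
    using abc(4)[THEN arg_cong, of "\<lambda>p. coeff p 0"] abc(4)[THEN arg_cong, of "\<lambda>p. coeff p 1"]
      abc(4)[THEN arg_cong, of "\<lambda>p. coeff p 2"]
    by (simp_all add: ga_be_al_def numeral_2_eq_2 algebra_simps)
  \<comment> \<open>The polynomial case asks for numerator and denominator without common roots,
    while \<open>P / Q\<close> need not be reduced.\<close>
  have "gcd (?h P) (?h Q) \<noteq> 0" using R(2) by simp
  then obtain p q where pq: "?h P = p * gcd (?h P) (?h Q)" "?h Q = q * gcd (?h P) (?h Q)" "coprime p q"
    using gcd_coprime_exists by blast
  define g where "g = gcd (?h P) (?h Q)"
  note pq = pq[folded g_def]
  have nz: "g \<noteq> 0" "q \<noteq> 0" "?h V \<noteq> 0" using R(2) S(2) pq(2) by auto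
  have factored: "[:to_ac ga:] * w^3 + [:to_ac be:] * u * w^2 + [:to_ac al:] * u^2 * w + u^3 =
      (u - smult a w) * (u - smult b w) * (u - smult c w)" for u w
  proof -
    define A B C where "A = [:a:]" "B = [:b:]" "C = [:c:]"
    have coeffs: "[:to_ac ga:] = - (A * B * C)" "[:to_ac be:] = A * B + A * C + B * C"
      "[:to_ac al:] = - (A + B + C)" "smult a w = A * w" "smult b w = B * w" "smult c w = C * w"
      unfolding co A_B_C_def by (simp_all add: ac_simps)
    show ?thesis unfolding coeffs by (simp add: algebra_simps power2_eq_square power3_eq_cube)
  qed
  have lin: "p * g - smult d (q * g) = g * (p - smult d q)" for d
    by (simp add: algebra_simps)
  have "g^3 * (?h U^2 * q^3) = g^3 * (?h V^2 * ((p - smult a q) * (p - smult b q) * (p - smult c q)))"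
    using h unfolding factored unfolding pq(1,2) lin
    by (simp only: power_mult_distrib power3_eq_cube ac_simps)
  then have e: "?h U^2 * q^3 = ?h V^2 * ((p - smult a q) * (p - smult b q) * (p - smult c q))"
    using nz(1) by simp
  have "poly q z \<noteq> 0" if "poly p z = 0" for z
    using that pq(3) coprime_common_divisor[of p q "[:-z, 1:]"] by (auto simp: poly_eq_0_iff_dvd)
  moreover have "(2 :: 'k alg_closure) \<noteq> 0"
    using two to_ac_eq_0_iff[of "2 :: 'k"] by simp
  ultimately have "degree p = 0" "degree q = 0"
    using elliptic_curve_no_polynomial_param[OF _ abc(1-3) nz(2,3) _ e] by blast+
  then obtain p0 q0 where p0: "p = [:p0:]" "q = [:q0:]" by (metis degree_eq_zeroE)
  with nz have "q0 \<noteq> 0" by auto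
  have PQ: "?h P * q = ?h Q * p" unfolding pq(1,2) by (simp only: ac_simps)
  have co: "to_ac (coeff P i) * q0 = to_ac (coeff Q i) * p0" for i
    using arg_cong[OF PQ, of "\<lambda>p. coeff p i"] unfolding p0 by (simp add: mult.commute)
  \<comment> \<open>At index \<open>degree Q\<close> the coefficient of \<open>Q\<close> is nonzero,
    so \<open>p0 / q0\<close> is the image of a quotient of coefficients from the base
    field.\<close>
  define k where "k = coeff P (degree Q) / lead_coeff Q"
  have "to_ac k = p0 / q0"
    using co[of "degree Q"] R(2) \<open>q0 \<noteq> 0\<close> by (simp add: k_def field_simps)
  then have "q0 * to_ac (coeff P i) = q0 * to_ac (k * coeff Q i)" for i
    using co[of i] \<open>q0 \<noteq> 0\<close> by (simp add: mult.commute)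
  then have "to_ac (coeff P i) = to_ac (k * coeff Q i)" for i
    using \<open>q0 \<noteq> 0\<close> mult_left_cancel by blast
  then have "coeff P i = k * coeff Q i" for i
    unfolding to_ac_eq_iff .
  then have "P = [:k:] * Q"
    by (intro poly_eqI) simp
  then have "R = to_fract [:k:]" using R by (simp del: mult_pCons_left)
  then show ?thesis ..
qed

section \<open>Specialising full matrices\<close>

lemma poly_mapping_add_induct [case_names zero add]:
  assumes "P 0" "\<And>a b f. P f \<Longrightarrow> P (Poly_Mapping.single a b + f)"
  shows "P (f :: 'a \<Rightarrow>\<^sub>0 'b::monoid_add)"
proof (induction f rule: update_induct)
  case const
  show ?case by (rule assms(1))
next
  case (update f a b)
  then have "Poly_Mapping.update a b f = Poly_Mapping.single a b + f"
    by (intro poly_mapping_eqI) (auto simp: lookup_update lookup_add lookup_single in_keys_iff when_def)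
  then show ?case using assms(2) update by simp
qed

text \<open>Since scalars commute, this evaluation factors through commutative polynomials and kills
  every commutator.\<close>

definition eval_scalars :: "(gen \<Rightarrow> 'k) \<Rightarrow> 'k::field free_algebra \<Rightarrow> 'k" where
  "eval_scalars e p = Sum_any (\<lambda>w. Poly_Mapping.lookup p w * prod_list (map e (letters w)))"

lemma eval_scalars_single:
  "eval_scalars e (Poly_Mapping.single w c) = c * prod_list (map e (letters w))"
proof -
  have "eval_scalars e (Poly_Mapping.single w c) =
      Sum_any (\<lambda>v. c * prod_list (map e (letters v)) when v = w)"
    unfolding eval_scalars_def by (rule Sum_any.cong) (auto simp: lookup_single when_def)
  then show ?thesis by simp
qed

lemma eval_scalars_add: "eval_scalars e (p + q) = eval_scalars e p + eval_scalars e q"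
  unfolding eval_scalars_def lookup_add distrib_right
  by (rule Sum_any.distrib) (rule finite_mult_not_eq_zero_rightI, rule finite_lookup)+

lemma eval_scalars_zero: "eval_scalars e 0 = 0"
  by (simp add: eval_scalars_def)

lemma eval_scalars_single_mult:
  "eval_scalars e (Poly_Mapping.single w c * q) = eval_scalars e (Poly_Mapping.single w c) * eval_scalars e q"
  by (induction q rule: poly_mapping_add_induct)
    (simp_all add: distrib_left eval_scalars_add mult_single eval_scalars_single plus_word_def eval_scalars_zero)

lemma eval_scalars_mult: "eval_scalars e (p * q) = eval_scalars e p * eval_scalars e q"
  by (induction p rule: poly_mapping_add_induct)
    (simp_all add: distrib_right eval_scalars_add eval_scalars_single_mult eval_scalars_zero)

lemma eval_scalars_hom: "Ring_Hom.ring_hom (eval_scalars e)"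
proof
  show "eval_scalars e 1 = 1"
    using eval_scalars_single[of e 0 1] by (simp only: single_one) (simp add: zero_word_def)
qed (simp_all add: eval_scalars_add eval_scalars_mult eval_scalars_zero)

lemma eval_scalars_gen [simp]: "eval_scalars e (gen g) = e g"
  and eval_scalars_const [simp]: "eval_scalars e (const c) = c"
  by (simp_all add: gen_def const_def eval_scalars_single zero_word_def)

lemma const_central: "const c * p = p * const c"
  by (induction p rule: poly_mapping_add_induct)
    (simp_all add: algebra_simps const_def mult_single mult.commute)

section \<open>Full matrices, determinants and kernels\<close>

text \<open>Padding both factors with zeros to size \<open>n\<close> keeps the product, and row
  \<open>r\<close> of the padded right factor is zero.\<close>

lemma det_thin_product_zero:
  fixes P Q :: "'a::idom mat"
  assumes "P \<in> carrier_mat n r" "Q \<in> carrier_mat r n" "r < n"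
  shows "det (P * Q) = 0"
proof -
  define P' Q' where "P' = mat n n (\<lambda>(i, j). if j < r then P $$ (i, j) else 0)"
    and "Q' = mat n n (\<lambda>(i, j). if i < r then Q $$ (i, j) else 0)"
  have carr: "P' \<in> carrier_mat n n" "Q' \<in> carrier_mat n n"
    by (simp_all add: P'_def Q'_def)
  have "P * Q = P' * Q'"
  proof (rule eq_matI)
    fix i j assume "i < dim_row (P' * Q')" "j < dim_col (P' * Q')"
    then have ij: "i < n" "j < n" using carr by auto
    have "(P * Q) $$ (i, j) = (\<Sum>k<r. P $$ (i, k) * Q $$ (k, j))"
      using assms ij by (simp add: scalar_prod_def atLeast0LessThan)
    also have "\<dots> = (\<Sum>k<n. P' $$ (i, k) * Q' $$ (k, j))"
      using assms ij by (intro sum.mono_neutral_cong_left) (auto simp: P'_def Q'_def)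
    also have "\<dots> = (P' * Q') $$ (i, j)"
      using carr ij by (simp add: scalar_prod_def atLeast0LessThan)
    finally show "(P * Q) $$ (i, j) = (P' * Q') $$ (i, j)" .
  qed (use assms carr in auto)
  moreover have "Q' = mat\<^sub>r n n (\<lambda>i. if i = r then 0\<^sub>v n else row Q' i)"
    by (rule eq_matI) (auto simp: Q'_def)
  then have "det Q' = 0"
    using det_row_0[OF assms(3), of "row Q'"] carr by simp
  ultimately show ?thesis using det_mult[OF carr] by simp
qed

text \<open>One specialisation certifies fullness: \<epsilon> would carry a thin factorisation to
  one over a domain and force the determinant to vanish.\<close>

lemma full_mat_if_det_nonzero:
  assumes "Ring_Hom.ring_hom \<epsilon>" "A \<in> carrier_mat n n"
    and "det (map_mat \<epsilon> A :: 'a::idom mat) \<noteq> 0"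
  shows "full_mat A"
proof -
  interpret e: Ring_Hom.ring_hom \<epsilon> by fact
  have "det (map_mat \<epsilon> A) = 0" if "r < n" "P \<in> carrier_mat n r" "Q \<in> carrier_mat r n" "A = P * Q" for r P Q
  proof -
    have "map_mat \<epsilon> A = map_mat \<epsilon> P * map_mat \<epsilon> Q"
      unfolding that(4) by (rule e.mat_hom_mult[OF that(2,3)])
    then show ?thesis
      using det_thin_product_zero[of "map_mat \<epsilon> P" n r "map_mat \<epsilon> Q"] that by simp
  qed
  then show ?thesis using assms unfolding full_mat_def by auto
qed

lemma invertible_mat_kernel:
  fixes A :: "'a::ring_1 mat"
  assumes "invertible_mat A" "A \<in> carrier_mat n n" "v \<in> carrier_vec n" "A *\<^sub>v v = 0\<^sub>v n"
  shows "v = 0\<^sub>v n"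
proof -
  obtain B where B': "B * A = 1\<^sub>m (dim_row B)" "A * B = 1\<^sub>m n"
    using assms(1,2) unfolding invertible_mat_def inverts_mat_def by auto
  \<comment> \<open>Invertibility only provides some two-sided inverse; its size is read off from
    the two identity matrices.\<close>
  have "dim_row B = n" using arg_cong[OF B'(1), of dim_col] assms(2) by simp
  moreover have "dim_col B = n" using arg_cong[OF B'(2), of dim_col] by simp
  ultimately have Bc: "B \<in> carrier_mat n n" and B: "B * A = 1\<^sub>m n"
    using B'(1) by auto
  have "v = (B * A) *\<^sub>v v" using B assms(3) by simp
  also have "\<dots> = B *\<^sub>v (A *\<^sub>v v)" using Bc assms by (intro assoc_mult_mat_vec)
  also have "\<dots> = 0\<^sub>v n" unfolding assms(4) using Bc by (intro eq_vecI) auto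
  finally show ?thesis .
qed

section \<open>Consequences of universality\<close>

context free_skew_field
begin

text \<open>The elements commuting with a given one form a skew subfield. For a constant it contains
  the image of \<iota>, hence everything, by generation.\<close>

lemma const_image_central: "\<iota> (const c) * u = u * \<iota> (const c)"
proof -
  have "u \<in> skew_field_generated (range \<iota>)" using generated by simp
  then show ?thesis
  proof induction
    case (incl a)
    then show ?case by (metis const_central hom_mult imageE)
  next
    case (mult a b)
    then show ?case by (metis mult.assoc)
  next
    case (inverse a)
    show ?case
    proof (cases "a = 0")
      case False
      then have "inverse a * (a * \<iota> (const c)) * inverse a = \<iota> (const c) * inverse a"
        by (simp add: mult.assoc[symmetric])
      moreover have "inverse a * (\<iota> (const c) * a) * inverse a = inverse a * \<iota> (const c)"
        using False by (simp add: mult.assoc)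
      ultimately show ?thesis by (metis inverse.IH)
    qed simp
  qed (simp_all add: algebra_simps)
qed

text \<open>A nonzero 1 by 1 matrix is full, because a product through size 0 is an empty sum. Its
  image is therefore invertible and cannot be zero.\<close>

lemma injective: "\<iota> a = 0 \<Longrightarrow> a = 0"
proof (rule ccontr)
  assume a: "\<iota> a = 0" "a \<noteq> 0"
  define A where "A = mat 1 1 (\<lambda>_. a)"
  have "A \<noteq> P * Q" if "P \<in> carrier_mat 1 0" "Q \<in> carrier_mat 0 1" for P Q
  proof
    assume "A = P * Q"
    then have "A $$ (0, 0) = (P * Q) $$ (0, 0)" by simp
    then show False using that a(2) by (simp add: A_def scalar_prod_def)
  qed
  then have "full_mat A" by (auto simp: full_mat_def A_def)
  then have inv: "invertible_mat (map_mat \<iota> A)" by (subst invertible_iff_full) (auto simp: A_def)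
  have "map_mat \<iota> A *\<^sub>v vec 1 (\<lambda>_. 1) = 0\<^sub>v 1"
    using a by (intro eq_vecI) (auto simp: A_def scalar_prod_def)
  then have "vec 1 (\<lambda>_. 1) = (0\<^sub>v 1 :: 'd vec)"
    by (rule invertible_mat_kernel[OF inv, rotated -1]) (auto simp: A_def)
  from arg_cong[OF this, of "\<lambda>u. vec_index u 0"] show False by simp
qed

text \<open>
  A singular matrix over the skew field is not full, and a factorisation through a smaller size
  survives every homomorphism to a field.
\<close>

lemma kernel_specialises:
  fixes A :: "nat \<Rightarrow> nat \<Rightarrow> 'k free_algebra" and \<epsilon> :: "'k free_algebra \<Rightarrow> 'c::field"
  assumes "Ring_Hom.ring_hom \<epsilon>"
    and "\<And>i. i < n \<Longrightarrow> (\<Sum>j<n. \<iota> (A i j) * v j) = 0" "\<exists>j<n. v j \<noteq> 0"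
  shows "\<exists>w. (\<forall>i<n. (\<Sum>j<n. \<epsilon> (A i j) * w j) = 0) \<and> (\<exists>j<n. w j \<noteq> 0)"
proof -
  define M where "M = mat n n (\<lambda>(i, j). A i j)"
  have M: "M \<in> carrier_mat n n" by (simp add: M_def)
  have "\<not> invertible_mat (map_mat \<iota> M)"
  proof
    assume inv: "invertible_mat (map_mat \<iota> M)"
    have "map_mat \<iota> M *\<^sub>v vec n v = 0\<^sub>v n"
      using assms(2) by (intro eq_vecI) (auto simp: M_def scalar_prod_def atLeast0LessThan)
    then have v0: "vec n v = 0\<^sub>v n"
      by (rule invertible_mat_kernel[OF inv, rotated -1]) (use M in auto)
    have "v j = 0" if "j < n" for j
      using arg_cong[OF v0, of "\<lambda>u. vec_index u j"] that by simp
    then show False using assms(3) by blast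
  qed
  then have "\<not> full_mat M" using invertible_iff_full[of M] M by auto
  then have "det (map_mat \<epsilon> M) = 0"
    using full_mat_if_det_nonzero[OF assms(1) M] by blast
  then obtain w where w: "w \<in> carrier_vec n" "w \<noteq> 0\<^sub>v n" "map_mat \<epsilon> M *\<^sub>v w = 0\<^sub>v n"
    using det_0_iff_vec_prod_zero_field[of "map_mat \<epsilon> M" n] M by auto
  show ?thesis
  proof (intro exI[of _ "\<lambda>j. w $ j"] conjI allI impI)
    fix i assume "i < n"
    then show "(\<Sum>j<n. \<epsilon> (A i j) * w $ j) = 0"
      using arg_cong[OF w(3), of "\<lambda>u. vec_index u i"] w(1)
      by (simp add: M_def scalar_prod_def atLeast0LessThan)
  next
    show "\<exists>j<n. w $ j \<noteq> 0" using w(1,2) eq_vecI[of w "0\<^sub>v n"] by auto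
  qed
qed

text \<open>The isomorphism pulls \<open>r\<close> and \<open>s\<close> back to a point of the curve
  over the rational function field. Its first coordinate is constant, and constants are sent to
  constants.\<close>

lemma not_rational_if_elliptic:
  fixes f :: "'k poly"
  assumes "(2::'k) \<noteq> 0" "degree f = 3" "lead_coeff f = 1" "rsquarefree (map_poly to_ac f)"
    and "r \<in> A" "s \<in> A" "s^2 = poly_at \<iota> f r" "r \<notin> range (\<lambda>c. \<iota> (const c))"
  shows "\<not> rational \<iota> A"
proof
  assume "rational \<iota> A"
  then obtain \<phi> :: "'k poly fract \<Rightarrow> 'd" where \<phi>: "Ring_Hom.ring_hom \<phi>" "bij_betw \<phi> UNIV A"
    and const: "\<And>c. \<phi> (to_fract [:c:]) = \<iota> (const c)"
    unfolding rational_def by blast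
  interpret \<phi>: Ring_Hom.ring_hom \<phi> by fact
  obtain R S where RS: "r = \<phi> R" "s = \<phi> S"
    using assms(5,6) \<phi>(2) unfolding bij_betw_def by blast
  have "\<phi> (S^2) = \<phi> (\<Sum>i\<le>degree f. to_fract [:coeff f i:] * R^i)"
    using assms(7) unfolding RS poly_at_def
    by (simp add: \<phi>.hom_sum \<phi>.hom_mult \<phi>.hom_power const)
  moreover have "inj \<phi>" using \<phi>(2) by (rule bij_betw_imp_inj_on)
  ultimately have "S^2 = (\<Sum>i\<le>degree f. to_fract [:coeff f i:] * R^i)"
    by (simp add: inj_eq)
  then obtain c where "R = to_fract [:c:]"
    using elliptic_curve_no_rational_param assms(1-4) by blast
  then have "r = \<iota> (const c)" using RS(1) const by simp
  then show False using assms(8) by blast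
qed

end

section \<open>The elements r and s of the free skew field\<close>

lemma gen_commutator_nonzero: "gen GenX * gen GenY - gen GenY * gen GenX \<noteq> (0 :: 'k::field free_algebra)"
proof -
  have "Poly_Mapping.lookup (gen GenX * gen GenY - gen GenY * gen GenX :: 'k free_algebra) (Word [GenX, GenY]) = 1"
    by (simp add: gen_def mult_single plus_word_def lookup_minus lookup_single)
  then show ?thesis by (metis lookup_zero zero_neq_one)
qed

theorem corollary5p3:
  fixes \<iota> :: "'k::field free_algebra \<Rightarrow> 'd::division_ring"
    and f :: "'k poly"
    and x y b1 b2 r s :: 'd
  assumes "free_skew_field \<iota>"
    and "CHAR('k) \<noteq> 2"
    and "degree f = 3" and "lead_coeff f = 1"
    and "rsquarefree (map_poly to_ac f)"
    and "x = \<iota> (gen GenX)" and "y = \<iota> (gen GenY)"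
    and "b1 = inverse (x * y - y * x) * (poly_at \<iota> f x - y\<^sup>2)"
    and "b2 = inverse (x * y - y * x) * (x\<^sup>2 * y - y * x\<^sup>2)"
    and "r = b1\<^sup>2 - b2 - \<iota> (const (coeff f 2))"
    and "s = y - x * b1 + b1 * r"
  shows "r \<notin> range (\<lambda>c. \<iota> (const c)) \<and> s \<notin> range (\<lambda>c. \<iota> (const c)) \<and>
         r * s = s * r \<and> s\<^sup>2 = poly_at \<iota> f r \<and>
         \<not> rational \<iota> (centralizer r) \<and> \<not> rational \<iota> (centralizer s)"
proof -
  interpret free_skew_field \<iota> by fact
  define gX gY Z :: "'k free_algebra"
    where "gX = gen GenX" and "gY = gen GenY" and "Z = gX * gY - gY * gX"
  define K where "K i = const (coeff f i)" for i
  define G H where "G = K 0 + K 1 * gX + K 2 * (gX * gX) + gX * gX * gX - gY * gY"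
    and "H = gX * gX * gY - gY * (gX * gX)"
  define z where "z = x * y - y * x"
  have xy: "\<iota> gX = x" "\<iota> gY = y" using assms by (simp_all add: gX_def gY_def)
  have \<iota>Z: "\<iota> Z = z" by (simp add: Z_def z_def hom_minus hom_mult xy)
  have "z \<noteq> 0"
    using injective[of Z] gen_commutator_nonzero[where 'k = 'k] \<iota>Z by (auto simp: Z_def gX_def gY_def)
  have poly_at: "poly_at \<iota> f u = \<iota> (K 0) + \<iota> (K 1) * u + \<iota> (K 2) * u^2 + u^3" for u
  proof -
    have "\<iota> (const 1) = 1" by (simp add: const_def)
    then show ?thesis
      using assms(3,4) by (simp add: poly_at_def K_def numeral_3_eq_3 numeral_2_eq_2 del: power_Suc)
  qed
  have \<iota>G: "\<iota> G = poly_at \<iota> f x - y^2"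
    by (simp add: G_def poly_at hom_minus hom_add hom_mult xy power2_eq_square power3_eq_cube mult.assoc)
  have \<iota>H: "\<iota> H = x^2 * y - y * x^2"
    by (simp add: H_def hom_minus hom_mult xy power2_eq_square)
  have zb1: "z * b1 = \<iota> G" and zb2: "z * b2 = \<iota> H"
    using \<open>z \<noteq> 0\<close> unfolding assms(8,9) \<iota>G \<iota>H z_def[symmetric] by (simp_all add: mult.assoc[symmetric])
  have central: "u * \<iota> (K i) = \<iota> (K i) * u" for u i
    by (simp add: K_def const_image_central)
  have r: "r = b1^2 - b2 - \<iota> (K 2)" using assms(10) by (simp add: K_def)
  have curve: "r * s = s * r" "s^2 = poly_at \<iota> f r"
    using noncommutative_cubic_curve[OF central central central z_def \<open>z \<noteq> 0\<close> _ _ r assms(11)]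
      zb1 zb2 unfolding \<iota>G \<iota>H poly_at by blast+

  have zr: "z * r = \<iota> G * b1 - \<iota> H - \<iota> (K 2) * z"
    by (simp add: r power2_eq_square right_diff_distrib zb2 central flip: zb1 mult.assoc)
  have zs: "z * s = z * y - z * x * b1 + \<iota> G * r"
    by (simp add: assms(11) algebra_simps flip: zb1)
  \<comment> \<open>At \<open>x = 0\<close>, \<open>y = e\<close> the numerator
    \<open>f - y^2\<close> takes the value \<open>coeff f 0 - e * e\<close>, so this choice keeps
    \<open>G\<close> nonzero while commutators vanish.\<close>
  obtain e where e: "coeff f 0 - e * e \<noteq> 0"
  proof (cases "coeff f 0 = 0")
    case True
    then show ?thesis using that[of 1] by simp
  next
    case False
    then show ?thesis using that[of 0] by simp
  qed
  define \<epsilon> where "\<epsilon> = eval_scalars (case_gen 0 e)"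
  interpret \<epsilon>: Ring_Hom.ring_hom \<epsilon> unfolding \<epsilon>_def by (rule eval_scalars_hom)
  have \<epsilon>gen: "\<epsilon> gX = 0" "\<epsilon> gY = e" by (simp_all add: \<epsilon>_def gX_def gY_def)
  have \<epsilon>: "\<epsilon> Z = 0" "\<epsilon> H = 0"
    by (simp_all add: Z_def H_def \<epsilon>.hom_minus \<epsilon>.hom_mult \<epsilon>gen)
  have "\<epsilon> G = coeff f 0 - e * e"
    by (simp add: G_def \<epsilon>.hom_minus \<epsilon>.hom_add \<epsilon>.hom_mult \<epsilon>gen) (simp add: \<epsilon>_def K_def)
  with e have \<epsilon>G: "\<epsilon> G \<noteq> 0" by simp

  have r_nonconst: "r \<noteq> \<iota> (const c)" for c
  proof
    assume rc: "r = \<iota> (const c)"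
    \<comment> \<open>The rows are \<open>z b1 = G\<close> and \<open>z r = G b1 - H - \<alpha> z\<close>, cleared of inverses and read as linear
      relations in \<open>(b1, 1)\<close>. At commuting values of the generators only the entries \<open>- G\<close> survive.\<close>
    define A where "A i j = [[Z, - G], [- G, H + (K 2 + const c) * Z]] ! i ! j" for i j
    have "z * r = \<iota> (const c) * z" unfolding rc by (simp add: const_image_central)
    with zr have "(\<Sum>j<2. \<iota> (A i j) * [b1, 1] ! j) = 0" if "i < 2" for i
      using less_2_cases[OF that]
      by (auto simp: A_def numeral_2_eq_2 hom_uminus hom_add hom_mult \<iota>Z zb1 algebra_simps)
    moreover have "\<exists>j<2. [b1, 1] ! j \<noteq> 0" by (intro exI[of _ 1]) simp
    ultimately have "\<exists>w. (\<forall>i<2. (\<Sum>j<2. \<epsilon> (A i j) * w j) = 0) \<and> (\<exists>j<2. w j \<noteq> 0)"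
      by (rule kernel_specialises[OF \<epsilon>.ring_hom_axioms])
    then obtain w where w: "\<And>i. i < 2 \<Longrightarrow> (\<Sum>j<2. \<epsilon> (A i j) * w j) = 0" "\<exists>j<2. w j \<noteq> 0"
      by blast
    then show False
      using w(1)[of 0] w(1)[of 1] \<epsilon>G
      by (auto simp: A_def numeral_2_eq_2 less_Suc_eq \<epsilon>.hom_uminus \<epsilon>.hom_add \<epsilon>.hom_mult \<epsilon>)
  qed

  have s_nonconst: "s \<noteq> \<iota> (const c)" for c
  proof
    assume sc: "s = \<iota> (const c)"
    \<comment> \<open>Since \<open>z * s\<close> contains \<open>G * r\<close>, the element
      \<open>r\<close> becomes a third unknown: the rows are the relations for
      \<open>z * b1\<close>, \<open>z * r\<close> and \<open>z * s = z * c\<close> in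
      \<open>(b1, r, 1)\<close>. After specialisation each row and each column keeps exactly one
      nonzero entry, \<open>G\<close> up to sign.\<close>
    define A where "A i j = [[Z, 0, - G], [- G, Z, H + K 2 * Z], [- (Z * gX), G, Z * (gY - const c)]] ! i ! j"
      for i j
    have "(\<Sum>j<3. \<iota> (A i j) * [b1, r, 1] ! j) = 0" if "i < 3" for i
    proof -
      have "i = 0 \<or> i = 1 \<or> i = 2" using that by linarith
      then consider "i = 0" | "i = 1" | "i = 2" by blast
      then show ?thesis
        using zr zs unfolding sc
        by cases (auto simp: A_def numeral_3_eq_3 numeral_2_eq_2 hom_uminus hom_minus hom_add hom_mult
            \<iota>Z zb1 xy algebra_simps)
    qed
    moreover have "\<exists>j<3. [b1, r, 1] ! j \<noteq> 0" by (intro exI[of _ 2]) simp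
    ultimately have "\<exists>w. (\<forall>i<3. (\<Sum>j<3. \<epsilon> (A i j) * w j) = 0) \<and> (\<exists>j<3. w j \<noteq> 0)"
      by (rule kernel_specialises[OF \<epsilon>.ring_hom_axioms])
    then obtain w where w: "\<And>i. i < 3 \<Longrightarrow> (\<Sum>j<3. \<epsilon> (A i j) * w j) = 0" "\<exists>j<3. w j \<noteq> 0"
      by blast
    then show False
      using w(1)[of 0] w(1)[of 1] w(1)[of 2] \<epsilon>G
      by (auto simp: A_def numeral_3_eq_3 numeral_2_eq_2 less_Suc_eq
          \<epsilon>.hom_uminus \<epsilon>.hom_minus \<epsilon>.hom_add \<epsilon>.hom_mult \<epsilon>)
  qed

  have "CHAR('k) \<noteq> 1" by simp
  with assms(2) have "\<not> CHAR('k) dvd 2"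
    using prime_nat_iff two_is_prime_nat by blast
  then have two: "(2::'k) \<noteq> 0"
    using of_nat_eq_0_iff_char_dvd[of 2, where 'a = 'k] by simp
  have "r \<in> centralizer r" "s \<in> centralizer r" "r \<in> centralizer s" "s \<in> centralizer s"
    using curve(1) by (simp_all add: centralizer_def)
  \<comment> \<open>Both cases rest on the same point \<open>(r, s)\<close> and on \<open>r\<close>
    being nonconstant.\<close>
  then have "\<not> rational \<iota> (centralizer r)" "\<not> rational \<iota> (centralizer s)"
    using not_rational_if_elliptic[OF two assms(3-5) _ _ curve(2)] r_nonconst by blast+
  then show ?thesis using r_nonconst s_nonconst curve by blast
qed

end
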